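(* Let $M$ be a binary matroid on ground set $V$ and let $Z$ be a basis of $M$. Then $M\bar{*}V*Z=\mathcal{M}_G$ for some graph $G$ on $V$, and $P_M(y)=(-1)^{\nu(M)}p_1(G)(y)$.
   Context: $M$ is identified with the set system $(V,\mathcal{B})$ of its bases; $\nu(M)=|V|$ minus the rank of $M$. For a set system $N=(V,D)$: twist $N*X=(V,\{Y\triangle X:Y\in D\})$; dual pivot $N\bar{*}X=(V,D'')$ with $Y\in D''$ iff the number of $W\in D$ with $Y\subseteq W\subseteq Y\cup X$ is odd; operations are applied left to right, so $M\bar*V*Z=(M\bar*V)*Z$; $d_N=\min\{|Y|:Y\in D\}$. $P_M(y)=\sum_{X\subseteq V}(-1)^{|X|}y^{d_{M*V\bar{*}X}}$ (for binary matroids this coincides with the Penrose polynomial of Aigner and Mielke). Graphs (loops allowed) are identified with symmetric $V\times V$ adjacency matrices over $\mathrm{GF}(2)$; $\mathcal{M}_G=(V,\{X\subseteq V: G[X]\text{ nonsingular}\})$ with the empty submatrix nonsingular; $p_1(G)(y)=\sum_{X\subseteq V}(-1)^{|X|}y^{d_{\mathcal{M}_G*X}}$. *)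

theory Defs
  imports
    "HOL-Library.Z2"
    "HOL-Combinatorics.Permutations"
    "HOL-Computational_Algebra.Polynomial"
begin

type_synonym 'a set_system = "'a set \<times> 'a set set"

definition twist :: "'a set_system \<Rightarrow> 'a set \<Rightarrow> 'a set_system" (infixl "\<^bold>*" 70) where
  "N \<^bold>* X = (fst N, (\<lambda>Y. sym_diff Y X) ` snd N)"

definition dual_pivot :: "'a set_system \<Rightarrow> 'a set \<Rightarrow> 'a set_system" (infixl "\<^bold>*\<^bold>-" 70) where
  "N \<^bold>*\<^bold>- X =
     (fst N, {Y. Y \<subseteq> fst N \<and> odd (card {W \<in> snd N. Y \<subseteq> W \<and> W \<subseteq> Y \<union> X})})"

definition min_size :: "'a set_system \<Rightarrow> nat" where
  "min_size N = Min (card ` snd N)"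

(* A matroid is identified with the set system of its bases. *)
definition matroid :: "'a set_system \<Rightarrow> bool" where
  "matroid M \<longleftrightarrow>
     finite (fst M) \<and> snd M \<subseteq> Pow (fst M) \<and> snd M \<noteq> {} \<and>
     (\<forall>B1 \<in> snd M. \<forall>B2 \<in> snd M. \<forall>x \<in> B1 - B2. \<exists>y \<in> B2 - B1. insert y (B1 - {x}) \<in> snd M)"

definition indep_set :: "'a set_system \<Rightarrow> 'a set \<Rightarrow> bool" where
  "indep_set M X \<longleftrightarrow> (\<exists>B \<in> snd M. X \<subseteq> B)"

definition matroid_rank :: "'a set_system \<Rightarrow> nat" where
  "matroid_rank M = Max (card ` snd M)"

definition nullity :: "'a set_system \<Rightarrow> nat" where
  "nullity M = card (fst M) - matroid_rank M"

(* Linear independence over GF(2) of the family of columns indexed by X of a matrix with m rows. *)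
definition lin_indep_columns :: "nat \<Rightarrow> (nat \<Rightarrow> 'a \<Rightarrow> bit) \<Rightarrow> 'a set \<Rightarrow> bool" where
  "lin_indep_columns m A X \<longleftrightarrow>
     (\<forall>c :: 'a \<Rightarrow> bit. (\<forall>i<m. (\<Sum>v\<in>X. c v * A i v) = 0) \<longrightarrow> (\<forall>v\<in>X. c v = 0))"

definition binary_matroid :: "'a set_system \<Rightarrow> bool" where
  "binary_matroid M \<longleftrightarrow> matroid M \<and>
     (\<exists>m A. \<forall>X \<subseteq> fst M. indep_set M X \<longleftrightarrow> lin_indep_columns m A X)"

definition penrose_poly :: "'a set_system \<Rightarrow> int poly" where
  "penrose_poly M = (\<Sum>X\<in>Pow (fst M). (-1) ^ card X * monom 1 (min_size (M \<^bold>* fst M \<^bold>*\<^bold>- X)))"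

(* A graph on V, loops allowed, is its V x V adjacency matrix over GF(2);
   values outside V x V are irrelevant. *)
definition graph_on :: "'a set \<Rightarrow> ('a \<Rightarrow> 'a \<Rightarrow> bit) \<Rightarrow> bool" where
  "graph_on V G \<longleftrightarrow> (\<forall>u\<in>V. \<forall>v\<in>V. G u v = G v u)"

(* Leibniz determinant of the principal submatrix G[X]; it is 1 for X = {}. *)
definition det_on :: "'a set \<Rightarrow> ('a \<Rightarrow> 'a \<Rightarrow> bit) \<Rightarrow> bit" where
  "det_on X G = (\<Sum>p | p permutes X. of_int (sign p) * (\<Prod>i\<in>X. G i (p i)))"

definition nonsingular_on :: "'a set \<Rightarrow> ('a \<Rightarrow> 'a \<Rightarrow> bit) \<Rightarrow> bool" where
  "nonsingular_on X G \<longleftrightarrow> det_on X G \<noteq> 0"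

definition graph_set_system :: "'a set \<Rightarrow> ('a \<Rightarrow> 'a \<Rightarrow> bit) \<Rightarrow> 'a set_system" where
  "graph_set_system V G = (V, {X. X \<subseteq> V \<and> nonsingular_on X G})"

definition p1 :: "'a set \<Rightarrow> ('a \<Rightarrow> 'a \<Rightarrow> bit) \<Rightarrow> int poly" where
  "p1 V G = (\<Sum>X\<in>Pow V. (-1) ^ card X * monom 1 (min_size (graph_set_system V G \<^bold>* X)))"

end

theory Submission
  imports Defs "Jordan_Normal_Form.Determinant"
begin

text \<open>
  Let \<open>F\<close> be the coordinates of the columns of \<open>M\<close> with respect to the basis \<open>Z\<close>, and let \<open>H\<close> be the
  bipartite graph with parts \<open>Z\<close> and \<open>V - Z\<close> given by \<open>F\<close>. A set \<open>B\<close> is a basis of \<open>M\<close> iff \<open>H\<close> restricted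
  to the symmetric difference of \<open>B\<close> and \<open>Z\<close> is nonsingular. Over \<open>GF(2)\<close>, adding a loop at \<open>z\<close> adds
  \<open>det H[Y - z]\<close> to \<open>det H[Y]\<close> if \<open>z \<in> Y\<close>, and replacing \<open>H\<^sub>a\<^sub>b\<close> by \<open>H\<^sub>a\<^sub>b + H\<^sub>a\<^sub>v H\<^sub>v\<^sub>b\<close> at a loopless \<open>v\<close> adds
  \<open>det H[Y + v]\<close> if \<open>v \<notin> Y\<close>. Doing the first at all \<open>z \<in> Z\<close> and then the second at all \<open>v \<in> V - Z\<close> yields
  a graph \<open>G\<close> for which \<open>det G[Y]\<close> is the parity of the number of bases containing the symmetric
  difference of \<open>Y\<close> and \<open>Z\<close>; this is the required graph. The Penrose identity then holds term by
  term: the term of \<open>X\<close> matches that of the symmetric difference of \<open>Z\<close> and \<open>V - X\<close>.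
\<close>

text \<open>These two rules turn \<open>GF(2)\<close> arithmetic into bit operations, which have no sum lemmas.\<close>

declare add_bit_eq_xor [simp del] mult_bit_eq_and [simp del]

lemma bit_add_self [simp]: "(a::bit) + a = 0"
  by (cases a) (simp_all only: add_0_left one_add_one bit_2_eq_0)

lemma bit_add_eq_0_iff [simp]: "(a::bit) + b = 0 \<longleftrightarrow> a = b"
  by (cases a; cases b) (simp_all add: one_add_one)

lemma of_int_sign_bit [simp]: "of_int (sign p) = (1::bit)"
  by (simp add: sign_def)

section \<open>Determinants and kernels over GF(2)\<close>

lemma det_on_eq_permanent: "det_on X G = (\<Sum>p | p permutes X. \<Prod>i\<in>X. G i (p i))"
  by (simp add: det_on_def)

lemma det_on_cong:
  assumes "\<And>u v. u \<in> X \<Longrightarrow> v \<in> X \<Longrightarrow> G u v = G' u v"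
  shows "det_on X G = det_on X G'"
  unfolding det_on_def
  by (intro sum.cong refl arg_cong2[where f = "(*)"] prod.cong)
    (auto intro!: assms simp: permutes_in_image)

text \<open>The kernel is phrased by sums over the index set, so that row operations and comparisons
  between matrices of different sizes need no ordering of \<open>X\<close>.\<close>

definition trivial_kernel :: "'a set \<Rightarrow> ('a \<Rightarrow> 'a \<Rightarrow> bit) \<Rightarrow> bool" where
  "trivial_kernel X G \<longleftrightarrow>
     (\<forall>c. (\<forall>u\<in>X. (\<Sum>v\<in>X. G u v * c v) = 0) \<longrightarrow> (\<forall>v\<in>X. c v = 0))"

text \<open>Enumerating \<open>X\<close> by \<open>f\<close> conjugates the permutations of
  \<open>X\<close> into those of \<open>{0..<n}\<close>, and every sign is 1 in GF(2). This opens
  the way to the singularity criterion for matrices over a field.\<close>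

lemma det_on_eq_det_mat:
  assumes f: "bij_betw f {0..<n} X"
  shows "det_on X G = det (mat n n (\<lambda>(i, j). G (f i) (f j)))"
proof -
  let ?N = "{0..<n}"
  let ?h = "\<lambda>\<pi> x. if x \<in> X then f (\<pi> (inv_into ?N f x)) else x"
  have "det_on X G = (\<Sum>p | p permutes X. \<Prod>i\<in>X. G i (p i))"
    by (rule det_on_eq_permanent)
  also have "\<dots> = (\<Sum>\<pi> | \<pi> permutes ?N. \<Prod>i\<in>X. G i (?h \<pi> i))"
    by (rule sum.reindex_bij_betw[OF bij_betw_permutations[OF f], symmetric])
  also have "\<dots> = (\<Sum>\<pi> | \<pi> permutes ?N. \<Prod>i\<in>?N. G (f i) (f (\<pi> i)))"
  proof (rule sum.cong[OF refl])
    fix \<pi> assume "\<pi> \<in> {\<pi>. \<pi> permutes ?N}"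
    have "(\<Prod>i\<in>X. G i (?h \<pi> i)) = (\<Prod>i\<in>?N. G (f i) (?h \<pi> (f i)))"
      by (rule prod.reindex_bij_betw[OF f, symmetric])
    also have "\<dots> = (\<Prod>i\<in>?N. G (f i) (f (\<pi> i)))"
    proof (rule prod.cong[OF refl])
      fix i assume "i \<in> ?N"
      then have "f i \<in> X" "inv_into ?N f (f i) = i"
        using f by (auto simp: bij_betw_def)
      then show "G (f i) (?h \<pi> (f i)) = G (f i) (f (\<pi> i))" by simp
    qed
    finally show "(\<Prod>i\<in>X. G i (?h \<pi> i)) = (\<Prod>i\<in>?N. G (f i) (f (\<pi> i)))" .
  qed
  also have "\<dots> = det (mat n n (\<lambda>(i, j). G (f i) (f j)))"
    unfolding det_def by (auto intro!: sum.cong prod.cong dest: permutes_in_image)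
  finally show ?thesis .
qed

lemma nonsingular_on_iff_trivial_kernel:
  assumes "finite X"
  shows "nonsingular_on X G \<longleftrightarrow> trivial_kernel X G"
proof -
  obtain f where f: "bij_betw f {0..<card X} X"
    using ex_bij_betw_nat_finite[OF assms] by blast
  let ?N = "{0..<card X}" and ?n = "card X"
  let ?A = "mat ?n ?n (\<lambda>(i, j). G (f i) (f j))"
  have fX: "f i \<in> X" if "i < ?n" for i using f that by (auto simp: bij_betw_def)
  have A: "?A \<in> carrier_mat ?n ?n" by simp
  have sums: "(?A *\<^sub>v vec ?n (\<lambda>i. c (f i))) $ i = (\<Sum>v\<in>X. G (f i) v * c v)" if "i < ?n" for c i
    using that by (simp add: scalar_prod_def sum.reindex_bij_betw[OF f, symmetric])
  show ?thesis
  proof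
    assume ns: "nonsingular_on X G"
    show "trivial_kernel X G"
      unfolding trivial_kernel_def
    proof (intro allI impI)
      fix c assume c: "\<forall>u\<in>X. (\<Sum>v\<in>X. G u v * c v) = 0"
      let ?v = "vec ?n (\<lambda>i. c (f i))"
      have "?A *\<^sub>v ?v = 0\<^sub>v ?n"
        using c fX by (intro eq_vecI) (auto simp: sums simp del: index_mult_mat_vec)
      then have v0: "?v = 0\<^sub>v ?n"
        using ns det_0_iff_vec_prod_zero_field[OF A] 
        unfolding nonsingular_on_def det_on_eq_det_mat[OF f] by (metis vec_carrier)
      show "\<forall>v\<in>X. c v = 0"
      proof
        fix v assume "v \<in> X"
        then obtain i where "i < ?n" "v = f i" 
          using bij_betw_imp_surj_on[OF f] by (metis imageE atLeastLessThan_iff)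
        then show "c v = 0" using arg_cong[OF v0, of "\<lambda>w. w $ i"] by simp
      qed
    qed
  next
    assume tk: "trivial_kernel X G"
    show "nonsingular_on X G"
      unfolding nonsingular_on_def
    proof
      assume "det_on X G = 0"
      then obtain w where w: "w \<in> carrier_vec ?n" "w \<noteq> 0\<^sub>v ?n" "?A *\<^sub>v w = 0\<^sub>v ?n"
        using det_0_iff_vec_prod_zero_field[OF A] unfolding det_on_eq_det_mat[OF f] by blast
      define c where "c = (\<lambda>v. w $ inv_into ?N f v)"
      have cf: "c (f i) = w $ i" if "i < ?n" for i
        using that f by (simp add: c_def bij_betw_def)
      have wv: "w = vec ?n (\<lambda>i. c (f i))"
        using w(1) by (intro eq_vecI) (auto simp: cf)
      have "\<forall>u\<in>X. (\<Sum>v\<in>X. G u v * c v) = 0"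
      proof
        fix u assume "u \<in> X"
        then obtain i where i: "i < ?n" "u = f i" 
          using bij_betw_imp_surj_on[OF f] by (metis imageE atLeastLessThan_iff)
        have "(?A *\<^sub>v vec ?n (\<lambda>i. c (f i))) $ i = 0" using w(3) wv i(1) by simp
        then show "(\<Sum>v\<in>X. G u v * c v) = 0" using i by (simp add: sums del: index_mult_mat_vec)
      qed
      then have "\<forall>v\<in>X. c v = 0" using tk unfolding trivial_kernel_def by blast
      then have "w = 0\<^sub>v ?n" by (subst wv) (auto simp: fX)
      with w(2) show False by contradiction
    qed
  qed
qed

text \<open>A value in GF(2) is settled by whether it vanishes, so comparing kernels proves equality
  of determinants, even for different index sets.\<close>

lemma det_on_eqI_trivial_kernel:
  assumes "finite X" "finite Y" "trivial_kernel X G \<longleftrightarrow> trivial_kernel Y H"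
  shows "det_on X G = det_on Y H"
  using assms nonsingular_on_iff_trivial_kernel[of X G] nonsingular_on_iff_trivial_kernel[of Y H]
  unfolding nonsingular_on_def by (metis bit_not_one_iff)

section \<open>Determinants under changes of the graph\<close>

text \<open>Only permutations fixing \<open>z\<close> meet the changed entry. Each contributes one
  extra product, and these permutations are exactly those of \<open>X - {z}\<close>.\<close>

lemma det_on_add_loop:
  assumes fin: "finite X"
  shows "det_on X (\<lambda>a b. G a b + of_bool (a = z \<and> b = z)) =
         det_on X G + (if z \<in> X then det_on (X - {z}) G else 0)"
proof (cases "z \<in> X")
  case False
  then show ?thesis by (auto intro!: det_on_cong)
next
  case True
  let ?G = "\<lambda>a b. G a b + of_bool (a = z \<and> b = z)"
  have X: "X = insert z (X - {z})" using True by auto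
  have split: "(\<Prod>i\<in>X. ?G i (p i)) =
      (\<Prod>i\<in>X. G i (p i)) + (if p z = z then \<Prod>i\<in>X - {z}. G i (p i) else 0)" for p
    by (simp add: prod.remove[OF fin True] distrib_right)
  have "det_on X ?G = (\<Sum>p | p permutes X. (\<Prod>i\<in>X. G i (p i)) +
      (if p z = z then \<Prod>i\<in>X - {z}. G i (p i) else 0))"
    unfolding det_on_eq_permanent by (simp only: split)
  also have "\<dots> = det_on X G + (\<Sum>p | p permutes X \<and> p z = z. \<Prod>i\<in>X - {z}. G i (p i))"
    using finite_permutations[OF fin]
    by (simp add: sum.distrib det_on_eq_permanent sum.If_cases Int_def)
  also have "{p. p permutes X \<and> p z = z} = {p. p permutes X - {z}}"
    using X by (auto intro: permutes_superset permutes_subset simp: permutes_not_in)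
  finally show ?thesis using True by (simp add: det_on_eq_permanent)
qed

lemma sum_Pow_insert:
  assumes "finite A" "v \<notin> A"
  shows "(\<Sum>S\<in>Pow (insert v A). f S) = (\<Sum>S\<in>Pow A. f S) + (\<Sum>S\<in>Pow A. f (insert v S))"
proof -
  have "inj_on (insert v) (Pow A)" using assms(2) by (auto simp: inj_on_def)
  moreover have "Pow A \<inter> insert v ` Pow A = {}" using assms(2) by auto
  ultimately show ?thesis
    using assms(1) by (simp add: Pow_insert sum.union_disjoint sum.reindex)
qed

text \<open>Each new loop in \<open>X\<close> offers a choice between keeping its vertex and
  deleting it; \<open>R\<close> collects the deleted ones.\<close>

lemma det_on_add_loops:
  assumes "finite P" "finite X"
  shows "det_on X (\<lambda>a b. G a b + of_bool (a = b \<and> a \<in> P)) = (\<Sum>R\<in>Pow (P \<inter> X). det_on (X - R) G)"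
  using assms
proof (induction P arbitrary: X rule: finite_induct)
  case empty
  then show ?case by simp
next
  case (insert z P)
  let ?K = "\<lambda>P a b. G a b + of_bool (a = b \<and> a \<in> P)"
  have "?K (insert z P) = (\<lambda>a b. ?K P a b + of_bool (a = z \<and> b = z))"
    using insert.hyps(2) by (auto simp: fun_eq_iff)
  then have step: "det_on X (?K (insert z P)) =
      det_on X (?K P) + (if z \<in> X then det_on (X - {z}) (?K P) else 0)"
    by (simp only: det_on_add_loop[OF insert.prems])
  show ?case
  proof (cases "z \<in> X")
    case True
    have "P \<inter> (X - {z}) = P \<inter> X" using insert.hyps(2) by auto
    moreover have "insert z P \<inter> X = insert z (P \<inter> X)" using True by auto
    moreover have "X - {z} - R = X - insert z R" for R by auto
    ultimately show ?thesis
      unfolding step using True insert.hyps insert.prems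
      by (simp add: insert.IH sum_Pow_insert)
  next
    case False
    then have "insert z P \<inter> X = P \<inter> X" by auto
    then show ?thesis unfolding step using False by (simp add: insert.IH[OF insert.prems])
  qed
qed

text \<open>If \<open>v \<in> X\<close>, the change adds multiples of row \<open>v\<close> to the
  rows, and \<open>G v v = 0\<close> leaves row \<open>v\<close> itself fixed, so the kernel stays
  the same. If \<open>v \<notin> X\<close>, the new matrix arises by eliminating \<open>v\<close>
  from a matrix on \<open>insert v X\<close>, whose determinant splits by the loop rule.\<close>

lemma det_on_dual_step:
  assumes fin: "finite X" and v: "G v v = 0"
  shows "det_on X (\<lambda>a b. G a b + G a v * G v b) =
         det_on X G + (if v \<in> X then 0 else det_on (insert v X) G)"
proof -
  let ?G' = "\<lambda>a b. G a b + G a v * G v b"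
  have expand: "(\<Sum>b\<in>X. ?G' a b * c b) = (\<Sum>b\<in>X. G a b * c b) + G a v * (\<Sum>b\<in>X. G v b * c b)"
    for a c by (simp add: distrib_right sum.distrib sum_distrib_left mult.assoc)
  show ?thesis
  proof (cases "v \<in> X")
    case True
    have "(\<forall>a\<in>X. (\<Sum>b\<in>X. ?G' a b * c b) = 0) \<longleftrightarrow> (\<forall>a\<in>X. (\<Sum>b\<in>X. G a b * c b) = 0)" for c
    proof
      assume *: "\<forall>a\<in>X. (\<Sum>b\<in>X. ?G' a b * c b) = 0"
      then have "(\<Sum>b\<in>X. ?G' v b * c b) = 0" using True by blast
      then have "(\<Sum>b\<in>X. G v b * c b) = 0" by (simp only: expand v) simp
      then show "\<forall>a\<in>X. (\<Sum>b\<in>X. G a b * c b) = 0" using * by (simp only: expand) simp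
    next
      assume *: "\<forall>a\<in>X. (\<Sum>b\<in>X. G a b * c b) = 0"
      then show "\<forall>a\<in>X. (\<Sum>b\<in>X. ?G' a b * c b) = 0" using True by (simp only: expand) simp
    qed
    then have "det_on X ?G' = det_on X G"
      by (intro det_on_eqI_trivial_kernel fin) (simp only: trivial_kernel_def)
    then show ?thesis using True by simp
  next
    case False
    \<comment> \<open>The Schur complement of the entry \<open>(v, v)\<close> after adding a loop at \<open>v\<close>.\<close>
    let ?L = "\<lambda>a b. G a b + of_bool (a = v \<and> b = v)"
    have L: "(\<Sum>b\<in>insert v X. ?L a b * c b) = (if a = v then c v else G a v * c v) + (\<Sum>b\<in>X. G a b * c b)"
      for a c
    proof -
      have "(\<Sum>b\<in>X. ?L a b * c b) = (\<Sum>b\<in>X. G a b * c b)"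
        using False by (intro sum.cong) auto
      then show ?thesis using fin False v by simp
    qed
    have "trivial_kernel (insert v X) ?L \<longleftrightarrow> trivial_kernel X ?G'"
    proof
      assume tk: "trivial_kernel (insert v X) ?L"
      show "trivial_kernel X ?G'"
        unfolding trivial_kernel_def
      proof (intro allI impI)
        fix c assume c: "\<forall>a\<in>X. (\<Sum>b\<in>X. ?G' a b * c b) = 0"
        \<comment> \<open>The diagonal entry of \<open>?L\<close> at \<open>v\<close> is 1, so the
          equation of row \<open>v\<close> forces exactly this value at \<open>v\<close>.\<close>
        define c' where "c' = c(v := \<Sum>b\<in>X. G v b * c b)"
        have c': "(\<Sum>b\<in>X. G a b * c' b) = (\<Sum>b\<in>X. G a b * c b)" for a
          using False by (intro sum.cong) (auto simp: c'_def)
        have "\<forall>a\<in>insert v X. (\<Sum>b\<in>insert v X. ?L a b * c' b) = 0"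
        proof
          fix a assume a: "a \<in> insert v X"
          show "(\<Sum>b\<in>insert v X. ?L a b * c' b) = 0"
          proof (cases "a = v")
            case True
            show ?thesis unfolding L c' by (simp add: True c'_def)
          next
            case False
            then have "(\<Sum>b\<in>X. ?G' a b * c b) = 0" using a c by blast
            then show ?thesis using False unfolding L c' expand by (simp add: c'_def)
          qed
        qed
        then have "\<forall>a\<in>insert v X. c' a = 0" using tk unfolding trivial_kernel_def by blast
        then show "\<forall>a\<in>X. c a = 0" using False by (auto simp: c'_def split: if_splits)
      qed
    next
      assume tk: "trivial_kernel X ?G'"
      show "trivial_kernel (insert v X) ?L"
        unfolding trivial_kernel_def
      proof (intro allI impI)
        fix c assume c: "\<forall>a\<in>insert v X. (\<Sum>b\<in>insert v X. ?L a b * c b) = 0"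
        then have cv: "c v = (\<Sum>b\<in>X. G v b * c b)" unfolding L by simp
        have "\<forall>a\<in>X. (\<Sum>b\<in>X. ?G' a b * c b) = 0"
        proof
          fix a assume a: "a \<in> X"
          then have "(\<Sum>b\<in>insert v X. ?L a b * c b) = 0" using c by blast
          moreover have "a \<noteq> v" using a False by blast
          ultimately show "(\<Sum>b\<in>X. ?G' a b * c b) = 0"
            unfolding L expand cv[symmetric] by simp
        qed
        then have "\<forall>a\<in>X. c a = 0" using tk unfolding trivial_kernel_def by blast
        then show "\<forall>a\<in>insert v X. c a = 0" using cv by simp
      qed
    qed
    then have "det_on X ?G' = det_on (insert v X) ?L"
      using fin by (intro det_on_eqI_trivial_kernel) auto
    also have "\<dots> = det_on (insert v X) G + det_on X G"
      using fin False by (subst det_on_add_loop) auto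
    finally show ?thesis using False by (simp add: add.commute)
  qed
qed

text \<open>Since \<open>K\<close> vanishes on pairs from \<open>T\<close>, the steps at different
  vertices do not interfere and together give the closed sum. A step at a vertex outside
  \<open>X\<close> either adds it or not; \<open>S\<close> collects the added ones.\<close>

lemma det_on_dual_steps:
  assumes "finite T" "finite X" "\<And>u v. u \<in> T \<Longrightarrow> v \<in> T \<Longrightarrow> K u v = 0"
  shows "det_on X (\<lambda>a b. K a b + (\<Sum>v\<in>T. K a v * K v b)) = (\<Sum>S\<in>Pow (T - X). det_on (X \<union> S) K)"
  using assms
proof (induction T arbitrary: X rule: finite_induct)
  case empty
  then show ?case by simp
next
  case (insert v T)
  let ?D = "\<lambda>T a b. K a b + (\<Sum>v\<in>T. K a v * K v b)"
  have IH: "det_on X (?D T) = (\<Sum>S\<in>Pow (T - X). det_on (X \<union> S) K)" if "finite X" for X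
    using that insert.prems(2) by (intro insert.IH) auto
  \<comment> \<open>Earlier corrections contain a factor \<open>K u v\<close> or
    \<open>K v u\<close> with \<open>u \<in> T\<close>, hence leave row and column \<open>v\<close>
    untouched.\<close>
  have Dv: "?D T a v = K a v" "?D T v b = K v b" for a b
    using insert.prems(2) by simp_all
  have "?D (insert v T) = (\<lambda>a b. ?D T a b + ?D T a v * ?D T v b)"
    unfolding Dv using insert.hyps by (auto simp: fun_eq_iff add_ac)
  moreover have "?D T v v = 0" unfolding Dv using insert.prems(2) by simp
  ultimately have step: "det_on X (?D (insert v T)) =
      det_on X (?D T) + (if v \<in> X then 0 else det_on (insert v X) (?D T))"
    using det_on_dual_step[OF insert.prems(1), of "?D T" v] by simp
  show ?case
  proof (cases "v \<in> X")
    case True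
    then have "insert v T - X = T - X" by auto
    then show ?thesis unfolding step using True by (simp add: IH[OF insert.prems(1)])
  next
    case False
    have "T - insert v X = T - X" using insert.hyps(2) by auto
    moreover have "insert v T - X = insert v (T - X)" using False by auto
    moreover have "insert v X \<union> S = X \<union> insert v S" for S by auto
    ultimately show ?thesis
      unfolding step using False insert.hyps insert.prems(1) by (simp add: IH sum_Pow_insert)
  qed
qed

section \<open>Parity counts and minimal sizes in set systems\<close>

text \<open>A nonempty interval has \<open>2 ^ card (B - A)\<close> members, which is odd only for
  exponent 0.\<close>

lemma odd_card_interval_iff:
  assumes "finite B"
  shows "odd (card {W. A \<subseteq> W \<and> W \<subseteq> B}) \<longleftrightarrow> A = B"
proof (cases "A \<subseteq> B")
  case True
  have "W \<in> (\<union>) A ` Pow (B - A)" if "A \<subseteq> W" "W \<subseteq> B" for W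
    using that by (intro image_eqI[of _ _ "W - A"]) auto
  then have "{W. A \<subseteq> W \<and> W \<subseteq> B} = (\<union>) A ` Pow (B - A)"
    using True by auto
  moreover have "inj_on ((\<union>) A) (Pow (B - A))"
    by (auto simp: inj_on_def)
  ultimately have "card {W. A \<subseteq> W \<and> W \<subseteq> B} = 2 ^ card (B - A)"
    using assms by (simp add: card_image card_Pow)
  then show ?thesis using True assms by auto
next
  case False
  then have "{W. A \<subseteq> W \<and> W \<subseteq> B} = {}" by auto
  then show ?thesis using False by (metis card.empty even_zero subset_refl)
qed

text \<open>Both sides are the parity of the number of pairs satisfying \<open>P\<close>, counted by
  first or by second component.\<close>

lemma odd_card_odd_card_iff:
  assumes "finite A" "finite D"
  shows "odd (card {W \<in> A. odd (card {C \<in> D. P W C})}) \<longleftrightarrow>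
         odd (card {C \<in> D. odd (card {W \<in> A. P W C})})"
proof -
  have "(\<Sum>W\<in>A. card {C \<in> D. P W C}) = (\<Sum>W\<in>A. \<Sum>C\<in>D. of_bool (P W C))"
    using assms by (simp add: Int_def)
  also have "\<dots> = (\<Sum>C\<in>D. \<Sum>W\<in>A. of_bool (P W C))" by (rule sum.swap)
  also have "\<dots> = (\<Sum>C\<in>D. card {W \<in> A. P W C})"
    using assms by (simp add: Int_def)
  finally show ?thesis
    using even_sum_iff[OF assms(1), of "\<lambda>W. card {C \<in> D. P W C}"]
      even_sum_iff[OF assms(2), of "\<lambda>C. card {W \<in> A. P W C}"] by simp
qed

text \<open>
  The set system on the left counts the members of \<open>D\<close> below \<open>Y\<close>; each member of minimal size
  is the only member below itself, so it survives.
\<close>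

lemma min_size_zeta:
  assumes "finite V" "D \<subseteq> Pow V"
  shows "min_size (V, {Y. Y \<subseteq> V \<and> odd (card {W \<in> D. W \<subseteq> Y})}) = min_size (V, D)"
proof -
  let ?E = "{Y. Y \<subseteq> V \<and> odd (card {W \<in> D. W \<subseteq> Y})}"
  have finD: "finite D" and finE: "finite ?E"
    using assms by (auto intro: finite_subset[of _ "Pow V"])
  have below: "\<exists>W\<in>D. W \<subseteq> Y" if "Y \<in> ?E" for Y
  proof -
    have "{W \<in> D. W \<subseteq> Y} \<noteq> {}" using that by fastforce
    then show ?thesis by blast
  qed
  show ?thesis
  proof (cases "D = {}")
    \<comment> \<open>Both families are empty here, so both sides are the same unspecified value of
      \<open>Min\<close>.\<close>
    case True
    then show ?thesis by simp
  next
    case False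
    define d where "d = Min (card ` D)"
    have "d \<in> card ` D" unfolding d_def using finD False by (intro Min_in) auto
    then obtain W0 where W0: "W0 \<in> D" "card W0 = d" by auto
    have dle: "d \<le> card W" if "W \<in> D" for W
      unfolding d_def using finD that by auto
    have "W = W0" if "W \<in> D" "W \<subseteq> W0" for W
      using that W0 dle[OF that(1)] assms
      by (metis PowD card_subset_eq finite_subset le_antisym card_mono subsetD)
    then have "{W \<in> D. W \<subseteq> W0} = {W0}" using W0 by auto
    then have W0E: "W0 \<in> ?E" using W0 assms by auto
    have "Min (card ` ?E) = d"
    proof (rule Min_eqI)
      fix n assume "n \<in> card ` ?E"
      then obtain Y where Y: "Y \<in> ?E" "n = card Y" by auto
      then obtain W where "W \<in> D" "W \<subseteq> Y" using below by blast
      moreover have "finite Y" using Y assms(1) by (auto intro: finite_subset)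
      ultimately show "d \<le> n" using Y dle card_mono by (metis le_trans)
    qed (use finE W0E W0 in auto)
    then show ?thesis by (simp add: min_size_def d_def)
  qed
qed

section \<open>Twists, dual pivots and the Penrose polynomial\<close>

lemma mem_twist_iff: "Y \<in> snd (N \<^bold>* X) \<longleftrightarrow> sym_diff Y X \<in> snd N"
proof
  assume "sym_diff Y X \<in> snd N"
  moreover have "Y = sym_diff (sym_diff Y X) X" by auto
  ultimately show "Y \<in> snd (N \<^bold>* X)" unfolding twist_def by auto
next
  assume "Y \<in> snd (N \<^bold>* X)"
  then obtain Q where "Q \<in> snd N" "Y = sym_diff Q X" by (auto simp: twist_def)
  moreover have "sym_diff (sym_diff Q X) X = Q" by auto
  ultimately show "sym_diff Y X \<in> snd N" by simp
qed

lemma twist_twist: "N \<^bold>* X \<^bold>* Y = N \<^bold>* sym_diff X Y"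
proof (rule prod_eqI)
  show "snd (N \<^bold>* X \<^bold>* Y) = snd (N \<^bold>* sym_diff X Y)"
  proof (rule Set.set_eqI)
    fix Q
    have "sym_diff (sym_diff Q Y) X = sym_diff Q (sym_diff X Y)" by auto
    then show "Q \<in> snd (N \<^bold>* X \<^bold>* Y) \<longleftrightarrow> Q \<in> snd (N \<^bold>* sym_diff X Y)"
      by (simp only: mem_twist_iff)
  qed
qed (simp add: twist_def)

lemma mem_dual_pivot_ground_iff:
  assumes "snd N \<subseteq> Pow (fst N)" "Y \<subseteq> fst N"
  shows "Y \<in> snd (N \<^bold>*\<^bold>- fst N) \<longleftrightarrow> odd (card {B \<in> snd N. Y \<subseteq> B})"
proof -
  have "{W \<in> snd N. Y \<subseteq> W \<and> W \<subseteq> Y \<union> fst N} = {B \<in> snd N. Y \<subseteq> B}"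
    using assms by auto
  then show ?thesis using assms(2) by (simp add: dual_pivot_def)
qed

text \<open>
  Summing \<open>M * V *- X\<close> over all subsets of \<open>Y\<close> gives an interval of subsets for each basis of the dual,
  and an interval has odd size only if it is a point. Hence \<open>min_size_zeta\<close> applies.
\<close>

lemma min_size_twist_dual_pivot:
  assumes fin: "finite (fst M)" and sub: "snd M \<subseteq> Pow (fst M)" and X: "X \<subseteq> fst M"
  shows "min_size (M \<^bold>* fst M \<^bold>*\<^bold>- X) = min_size (M \<^bold>*\<^bold>- fst M \<^bold>* (fst M - X))"
proof -
  let ?V = "fst M" and ?L = "M \<^bold>* fst M \<^bold>*\<^bold>- X" and ?R = "M \<^bold>*\<^bold>- fst M \<^bold>* (fst M - X)"
  let ?D = "snd (M \<^bold>* ?V)"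
  have inj: "inj_on (\<lambda>B. sym_diff B ?V) (snd M)"
    using sub by (auto simp: inj_on_def)
  have D: "?D = (\<lambda>B. sym_diff B ?V) ` snd M" by (simp add: twist_def)
  have Dsub: "?D \<subseteq> Pow ?V" using sub by (auto simp: twist_def)
  have finD: "finite ?D" using Dsub fin by (auto intro: finite_subset)
  have L: "fst ?L = ?V" "snd ?L \<subseteq> Pow ?V" by (auto simp: dual_pivot_def twist_def)
  have R: "fst ?R = ?V" "snd ?R \<subseteq> Pow ?V" by (auto simp: dual_pivot_def twist_def)
  have "odd (card {W \<in> snd ?L. W \<subseteq> Y}) \<longleftrightarrow> Y \<in> snd ?R" if Y: "Y \<subseteq> ?V" for Y
  proof -
    have finY: "finite Y" using Y fin by (rule finite_subset)
    have "{W \<in> snd ?L. W \<subseteq> Y} = {W \<in> Pow Y. odd (card {C \<in> ?D. W \<subseteq> C \<and> C \<subseteq> W \<union> X})}"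
      using Y by (auto simp: dual_pivot_def twist_def)
    then have "odd (card {W \<in> snd ?L. W \<subseteq> Y}) \<longleftrightarrow>
        odd (card {C \<in> ?D. odd (card {W \<in> Pow Y. W \<subseteq> C \<and> C \<subseteq> W \<union> X})})"
      using odd_card_odd_card_iff[of "Pow Y" ?D] finY finD by simp
    also have "{C \<in> ?D. odd (card {W \<in> Pow Y. W \<subseteq> C \<and> C \<subseteq> W \<union> X})} = {C \<in> ?D. C - X = Y \<inter> C}"
    proof -
      have "{W \<in> Pow Y. W \<subseteq> C \<and> C \<subseteq> W \<union> X} = {W. C - X \<subseteq> W \<and> W \<subseteq> Y \<inter> C}" for C by auto
      then show ?thesis by (simp only: odd_card_interval_iff[OF finite_Int[OF disjI1[OF finY]]])
    qed
    also have "{C \<in> ?D. C - X = Y \<inter> C} = (\<lambda>B. sym_diff B ?V) ` {B \<in> snd M. sym_diff Y (?V - X) \<subseteq> B}"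
    proof -
      \<comment> \<open>For the complement of a basis \<open>B\<close>, the equation says that
        \<open>Y\<close> and \<open>?V - X\<close> agree outside \<open>B\<close>, that is, they
        differ only inside \<open>B\<close>.\<close>
      have "sym_diff B ?V - X = Y \<inter> sym_diff B ?V \<longleftrightarrow> sym_diff Y (?V - X) \<subseteq> B" if "B \<in> snd M" for B
      proof -
        have "B \<subseteq> ?V" using that sub by auto
        then show ?thesis using X Y by blast
      qed
      then show ?thesis unfolding D by blast
    qed
    also have "card \<dots> = card {B \<in> snd M. sym_diff Y (?V - X) \<subseteq> B}"
      by (rule card_image, rule inj_on_subset[OF inj]) auto
    also have "odd \<dots> \<longleftrightarrow> Y \<in> snd ?R"
      unfolding mem_twist_iff using Y by (subst mem_dual_pivot_ground_iff[OF sub]) auto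
    finally show ?thesis .
  qed
  then have "snd ?R = {Y. Y \<subseteq> ?V \<and> odd (card {W \<in> snd ?L. W \<subseteq> Y})}"
    using R(2) by auto
  then have "?R = (?V, {Y. Y \<subseteq> ?V \<and> odd (card {W \<in> snd ?L. W \<subseteq> Y})})"
    using R(1) by (metis prod.collapse)
  moreover have "?L = (?V, snd ?L)" using L(1) by (metis prod.collapse)
  ultimately show ?thesis using min_size_zeta[OF fin L(2)] by metis
qed

lemma minus_one_power_card_sym_diff:
  assumes "finite A" "finite B"
  shows "(-1 :: 'b :: ring_1) ^ card (sym_diff A B) = (-1) ^ card A * (-1) ^ card B"
proof -
  have "card A = card (A - B) + card (A \<inter> B)" "card B = card (B - A) + card (A \<inter> B)"
    using assms by (auto simp: card_Diff_subset_Int Int_commute card_mono)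
  moreover have "card (sym_diff A B) = card (A - B) + card (B - A)"
    using assms by (intro card_Un_disjoint) auto
  ultimately have "card A + card B = card (sym_diff A B) + 2 * card (A \<inter> B)" by simp
  then have "even (card A + card B) \<longleftrightarrow> even (card (sym_diff A B))" by simp
  then show ?thesis unfolding power_add[symmetric] by (simp add: minus_one_power_iff)
qed

text \<open>The sum is reindexed by the involution sending \<open>X\<close> to
  \<open>sym_diff Z (fst M - X)\<close>. The twist by \<open>Z\<close> cancels the \<open>Z\<close>
  in the index, which leaves the twist by \<open>fst M - X\<close> of
  \<open>min_size_twist_dual_pivot\<close>.\<close>

lemma penrose_poly_eq_sum_twists:
  assumes fin: "finite (fst M)" and sub: "snd M \<subseteq> Pow (fst M)" and Z: "Z \<subseteq> fst M"
  shows "penrose_poly M = (-1) ^ (card (fst M) - card Z) *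
    (\<Sum>Y\<in>Pow (fst M). (-1) ^ card Y * monom 1 (min_size (M \<^bold>*\<^bold>- fst M \<^bold>* Z \<^bold>* Y)))"
proof -
  let ?V = "fst M"
  let ?f = "\<lambda>X. sym_diff Z (?V - X)"
  have bij: "bij_betw ?f (Pow ?V) (Pow ?V)"
    by (rule bij_betwI[where g = ?f]) (use Z in auto)
  have term_eq: "(-1) ^ card X * monom 1 (min_size (M \<^bold>* ?V \<^bold>*\<^bold>- X)) =
      (-1) ^ (card ?V - card Z) *
      ((-1) ^ card (?f X) * monom 1 (min_size (M \<^bold>*\<^bold>- ?V \<^bold>* Z \<^bold>* ?f X)) :: int poly)"
    if X: "X \<in> Pow ?V" for X
  proof -
    have finX: "finite X" "finite Z" using X Z fin by (auto intro: finite_subset)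
    have "M \<^bold>*\<^bold>- ?V \<^bold>* Z \<^bold>* ?f X = M \<^bold>*\<^bold>- ?V \<^bold>* (?V - X)"
      unfolding twist_twist using Z X by (intro arg_cong[where f = "twist (M \<^bold>*\<^bold>- ?V)"]) auto
    then have ms: "min_size (M \<^bold>* ?V \<^bold>*\<^bold>- X) = min_size (M \<^bold>*\<^bold>- ?V \<^bold>* Z \<^bold>* ?f X)"
      using min_size_twist_dual_pivot[OF fin sub] X by simp
    have cards: "card Z \<le> card ?V" "card X \<le> card ?V" "card (?V - X) = card ?V - card X"
      using X Z fin finX by (auto simp: card_mono card_Diff_subset)
    have "(-1) ^ card (?f X) = (-1) ^ card Z * ((-1) ^ card (?V - X) :: int poly)"
      using fin finX by (intro minus_one_power_card_sym_diff) auto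
    \<comment> \<open>The size of \<open>?f X\<close> has the parity of
      \<open>card Z + card ?V - card X\<close>; the prefactor cancels all but
      \<open>card X\<close>.\<close>
    then have "(-1) ^ (card ?V - card Z) * ((-1) ^ card (?f X) :: int poly) = (-1) ^ card X"
      using cards by (auto simp: minus_one_power_iff)
    then show ?thesis unfolding ms by (simp only: mult.assoc[symmetric])
  qed
  have "penrose_poly M = (\<Sum>X\<in>Pow ?V. (-1) ^ (card ?V - card Z) *
      ((-1) ^ card (?f X) * monom 1 (min_size (M \<^bold>*\<^bold>- ?V \<^bold>* Z \<^bold>* ?f X))))"
    unfolding penrose_poly_def by (rule sum.cong[OF refl term_eq])
  also have "\<dots> = (-1) ^ (card ?V - card Z) *
      (\<Sum>X\<in>Pow ?V. (-1) ^ card (?f X) * monom 1 (min_size (M \<^bold>*\<^bold>- ?V \<^bold>* Z \<^bold>* ?f X)))"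
    by (rule sum_distrib_left[symmetric])
  also have "(\<Sum>X\<in>Pow ?V. (-1) ^ card (?f X) * monom 1 (min_size (M \<^bold>*\<^bold>- ?V \<^bold>* Z \<^bold>* ?f X))) =
      (\<Sum>Y\<in>Pow ?V. (-1) ^ card Y * monom 1 (min_size (M \<^bold>*\<^bold>- ?V \<^bold>* Z \<^bold>* Y)) :: int poly)"
    by (rule sum.reindex_bij_betw[OF bij])
  finally show ?thesis .
qed

section \<open>Bases of matroids and coordinates over GF(2)\<close>

lemma matroid_basis_subset: "matroid M \<Longrightarrow> B \<in> snd M \<Longrightarrow> B \<subseteq> fst M"
  by (auto simp: matroid_def)

lemma matroid_basis_finite: "matroid M \<Longrightarrow> B \<in> snd M \<Longrightarrow> finite B"
  using matroid_basis_subset[of M B] by (auto simp: matroid_def intro: finite_subset)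

text \<open>An exchange keeps the size of \<open>B1\<close> and shrinks \<open>B1 - B2\<close>; once
  this difference is empty, \<open>B1\<close> lies inside \<open>B2\<close>.\<close>

lemma matroid_card_basis_le:
  assumes "matroid M" "B1 \<in> snd M" "B2 \<in> snd M"
  shows "card B1 \<le> card B2"
  using assms(2)
proof (induction "card (B1 - B2)" arbitrary: B1 rule: less_induct)
  case less
  have fin: "finite B" if "B \<in> snd M" for B
    using assms(1) that by (rule matroid_basis_finite)
  show ?case
  proof (cases "B1 \<subseteq> B2")
    case True
    then show ?thesis using fin[OF assms(3)] by (rule card_mono[rotated])
  next
    case False
    then obtain x where x: "x \<in> B1 - B2" by auto
    then obtain y where y: "y \<in> B2 - B1" "insert y (B1 - {x}) \<in> snd M"
      using assms(1) less.prems assms(3) unfolding matroid_def by metis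
    have "insert y (B1 - {x}) - B2 = (B1 - B2) - {x}" using y by auto
    then have "card (insert y (B1 - {x}) - B2) < card (B1 - B2)"
      using x fin[OF less.prems] by (metis card_Diff1_less finite_Diff)
    then have "card (insert y (B1 - {x})) \<le> card B2" using less.hyps y(2) by blast
    moreover have "card (insert y (B1 - {x})) = card B1"
      using x y fin[OF less.prems] by (simp add: card_Suc_Diff1 del: card_Diff_insert)
    ultimately show ?thesis by simp
  qed
qed

lemma matroid_card_basis:
  assumes "matroid M" "B1 \<in> snd M" "B2 \<in> snd M"
  shows "card B1 = card B2"
  using matroid_card_basis_le[OF assms] matroid_card_basis_le[OF assms(1,3,2)] by simp

lemma matroid_rank_eq_card_basis:
  assumes "matroid M" "Z \<in> snd M"
  shows "matroid_rank M = card Z"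
proof -
  have "card ` snd M = {card Z}"
    using matroid_card_basis[OF assms(1)] assms(2) by blast
  then show ?thesis by (simp add: matroid_rank_def)
qed

text \<open>Being a basis is separated into independence, which the representing matrix decides, and
  a condition on size.\<close>

lemma basis_iff_indep_card:
  assumes "matroid M" "Z \<in> snd M"
  shows "B \<in> snd M \<longleftrightarrow> indep_set M B \<and> card B = card Z"
proof
  assume "B \<in> snd M"
  then show "indep_set M B \<and> card B = card Z"
    unfolding indep_set_def using matroid_card_basis[OF assms(1) _ assms(2)] by blast
next
  assume B: "indep_set M B \<and> card B = card Z"
  then obtain B' where B': "B' \<in> snd M" "B \<subseteq> B'" by (auto simp: indep_set_def)
  moreover have "finite B'" using assms(1) B'(1) by (rule matroid_basis_finite)
  ultimately show "B \<in> snd M"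
    using B matroid_card_basis[OF assms(1) B'(1) assms(2)] by (metis card_subset_eq)
qed

text \<open>For \<open>v\<close> outside \<open>Z\<close>, the set \<open>insert v Z\<close> is
  larger than every basis, so its columns are dependent, and the dependence can be solved for column
  \<open>v\<close>.\<close>

lemma fundamental_coordinates:
  assumes M: "matroid M" and Z: "Z \<in> snd M"
    and A: "\<forall>X \<subseteq> fst M. indep_set M X \<longleftrightarrow> lin_indep_columns m A X"
  obtains F :: "'a \<Rightarrow> 'a \<Rightarrow> bit" where
    "\<And>i v. i < m \<Longrightarrow> v \<in> fst M \<Longrightarrow> A i v = (\<Sum>z\<in>Z. F z v * A i z)"
    "\<And>z u. z \<in> Z \<Longrightarrow> u \<in> Z \<Longrightarrow> F z u = of_bool (z = u)"
proof -
  have ZV: "Z \<subseteq> fst M" and finZ: "finite Z"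
    using matroid_basis_subset[OF M Z] matroid_basis_finite[OF M Z] .
  have indZ: "lin_indep_columns m A Z"
    using A ZV Z by (auto simp: indep_set_def)
  have "\<exists>f. \<forall>i<m. A i v = (\<Sum>z\<in>Z. f z * A i z)" if v: "v \<in> fst M" "v \<notin> Z" for v
  proof -
    have "\<not> indep_set M (insert v Z)"
    proof
      assume "indep_set M (insert v Z)"
      then obtain B where B: "B \<in> snd M" "insert v Z \<subseteq> B" by (auto simp: indep_set_def)
      have "finite B" using M B(1) by (rule matroid_basis_finite)
      then have "card (insert v Z) \<le> card B" using B(2) by (rule card_mono)
      then show False using matroid_card_basis[OF M B(1) Z] v finZ by simp
    qed
    then obtain c where c: "\<forall>i<m. (\<Sum>u\<in>insert v Z. c u * A i u) = 0" "\<exists>u\<in>insert v Z. c u \<noteq> 0"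
      using A ZV v unfolding lin_indep_columns_def by (metis insert_subset)
    have cs: "c v * A i v = (\<Sum>u\<in>Z. c u * A i u)" if "i < m" for i
      using c(1) that v finZ by simp
    \<comment> \<open>A zero coefficient at \<open>v\<close> would leave a nontrivial dependence
      within the basis \<open>Z\<close>.\<close>
    have "c v = 1"
    proof (rule ccontr)
      assume "c v \<noteq> 1"
      then have "c v = 0" by simp
      then have "\<forall>i<m. (\<Sum>u\<in>Z. c u * A i u) = 0" using cs by simp
      then have "\<forall>u\<in>Z. c u = 0" using indZ unfolding lin_indep_columns_def by blast
      then show False using c(2) \<open>c v = 0\<close> by auto
    qed
    then show ?thesis using cs by (intro exI[of _ c]) simp
  qed
  then obtain f where f: "\<And>v i. v \<in> fst M \<Longrightarrow> v \<notin> Z \<Longrightarrow> i < m \<Longrightarrow> A i v = (\<Sum>z\<in>Z. f v z * A i z)"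
    by metis
  define F where "F = (\<lambda>z v. if v \<in> Z then of_bool (z = v) else f v z)"
  show thesis
  proof (rule that[of F])
    fix i v assume iv: "i < m" "v \<in> fst M"
    show "A i v = (\<Sum>z\<in>Z. F z v * A i z)"
    proof (cases "v \<in> Z")
      case True
      then have "(\<Sum>z\<in>Z. F z v * A i z) = (\<Sum>z\<in>Z. if z = v then A i z else 0)"
        by (intro sum.cong) (auto simp: F_def)
      then show ?thesis using True finZ by simp
    next
      case False
      then show ?thesis using f iv by (simp add: F_def)
    qed
  qed (simp add: F_def)
qed

section \<open>Independent columns and the bipartite matrix\<close>

text \<open>Rows and columns have separate index sets because the blocks of \<open>F\<close> between
  \<open>Z\<close> and its complement need not be square.\<close>

definition cols_indep :: "'b set \<Rightarrow> 'a set \<Rightarrow> ('b \<Rightarrow> 'a \<Rightarrow> bit) \<Rightarrow> bool" where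
  "cols_indep P Q F \<longleftrightarrow> (\<forall>c. (\<forall>z\<in>P. (\<Sum>v\<in>Q. F z v * c v) = 0) \<longrightarrow> (\<forall>v\<in>Q. c v = 0))"

text \<open>Over GF(2) a linear combination of columns is a subset \<open>S\<close> of
  \<open>Q\<close>, and its value is given by its support in \<open>P\<close>. Injectivity of the
  linear map becomes injectivity between power sets, so dimension arguments become counting.\<close>

lemma cols_indep_inj_on:
  assumes "finite Q" "cols_indep P Q F"
  shows "inj_on (\<lambda>S. {z \<in> P. (\<Sum>v\<in>S. F z v) = 1}) (Pow Q)"
proof (rule inj_onI)
  fix S S' assume S: "S \<in> Pow Q" "S' \<in> Pow Q"
    and eq: "{z \<in> P. (\<Sum>v\<in>S. F z v) = 1} = {z \<in> P. (\<Sum>v\<in>S'. F z v) = 1}"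
  \<comment> \<open>In GF(2) this is the indicator of the symmetric difference of \<open>S\<close>
    and \<open>S'\<close>.\<close>
  let ?c = "\<lambda>v. of_bool (v \<in> S) + of_bool (v \<in> S') :: bit"
  have ind: "(\<Sum>v\<in>Q. F z v * of_bool (v \<in> T)) = (\<Sum>v\<in>T. F z v)" if "T \<subseteq> Q" for T z
  proof -
    have "(\<Sum>v\<in>Q. F z v * of_bool (v \<in> T)) = (\<Sum>v\<in>Q. if v \<in> T then F z v else 0)"
      by (intro sum.cong) auto
    also have "\<dots> = (\<Sum>v\<in>Q \<inter> T. F z v)"
      using assms(1) by (simp add: sum.inter_restrict)
    also have "Q \<inter> T = T" using that by auto
    finally show ?thesis .
  qed
  have "\<forall>z\<in>P. (\<Sum>v\<in>Q. F z v * ?c v) = 0"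
  proof
    fix z assume z: "z \<in> P"
    then have "(\<Sum>v\<in>S. F z v) = 1 \<longleftrightarrow> (\<Sum>v\<in>S'. F z v) = 1" using eq by blast
    then have "(\<Sum>v\<in>S. F z v) = (\<Sum>v\<in>S'. F z v)" by (metis bit_not_one_iff)
    then show "(\<Sum>v\<in>Q. F z v * ?c v) = 0"
      using S by (simp only: distrib_left sum.distrib ind Pow_iff) simp
  qed
  then have "\<forall>v\<in>Q. ?c v = 0"
    by (rule assms(2)[unfolded cols_indep_def, THEN spec[of _ ?c], THEN mp])
  then have "\<forall>v\<in>Q. v \<in> S \<longleftrightarrow> v \<in> S'" by (auto simp: of_bool_def split: if_splits)
  then show "S = S'" using S by auto
qed

lemma cols_indep_card_le:
  assumes "finite P" "finite Q" "cols_indep P Q F"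
  shows "card Q \<le> card P"
proof -
  have "card (Pow Q) \<le> card (Pow P)"
    using assms by (intro card_inj_on_le[OF cols_indep_inj_on]) auto
  then show ?thesis using assms by (simp add: card_Pow)
qed

text \<open>An injection between power sets of equal size is onto, so every unit vector is a sum of
  columns. A vector orthogonal to all columns is then orthogonal to every unit vector.\<close>

lemma cols_indep_transpose:
  assumes "finite P" "finite Q" "cols_indep P Q F" "card P = card Q"
  shows "cols_indep Q P (\<lambda>v z. F z v)"
  unfolding cols_indep_def
proof (intro allI impI ballI)
  fix d z0 assume d: "\<forall>v\<in>Q. (\<Sum>z\<in>P. F z v * d z) = 0" and z0: "z0 \<in> P"
  let ?\<Phi> = "\<lambda>S. {z \<in> P. (\<Sum>v\<in>S. F z v) = 1}"
  have "?\<Phi> ` Pow Q = Pow P"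
  proof (rule card_subset_eq)
    show "card (?\<Phi> ` Pow Q) = card (Pow P)"
      using assms by (simp add: card_image[OF cols_indep_inj_on] card_Pow)
  qed (use assms in auto)
  moreover have "{z0} \<in> Pow P" using z0 by simp
  ultimately obtain S where S: "S \<subseteq> Q" "?\<Phi> S = {z0}" by (metis (no_types, lifting) Pow_iff imageE)
  have e: "(\<Sum>v\<in>S. F z v) = of_bool (z = z0)" if "z \<in> P" for z
  proof -
    have "(\<Sum>v\<in>S. F z v) = 1 \<longleftrightarrow> z = z0" using S(2) that by blast
    then show ?thesis by (cases "z = z0") simp_all
  qed
  have "d z0 = (\<Sum>z\<in>P. if z = z0 then d z else 0)" using z0 assms(1) by simp
  also have "\<dots> = (\<Sum>z\<in>P. (\<Sum>v\<in>S. F z v) * d z)" by (intro sum.cong) (auto simp: e)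
  also have "\<dots> = (\<Sum>v\<in>S. \<Sum>z\<in>P. F z v * d z)"
    unfolding sum_distrib_right by (rule sum.swap)
  also have "\<dots> = 0" using d S(1) by (intro sum.neutral) auto
  finally show "d z0 = 0" .
qed

text \<open>In coordinates the columns in \<open>B \<inter> Z\<close> are unit vectors. They absorb
  the rows in \<open>B \<inter> Z\<close>, so only the rows \<open>Z - B\<close> and the columns
  \<open>B - Z\<close> matter.\<close>

lemma lin_indep_columns_iff_cols_indep:
  fixes F :: "'a \<Rightarrow> 'a \<Rightarrow> bit"
  assumes fin: "finite B" "finite Z" and ind: "lin_indep_columns m A Z"
    and FA: "\<And>i v. i < m \<Longrightarrow> v \<in> B \<Longrightarrow> A i v = (\<Sum>z\<in>Z. F z v * A i z)"
    and FZ: "\<And>z u. z \<in> Z \<Longrightarrow> u \<in> Z \<Longrightarrow> F z u = of_bool (z = u)"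
  shows "lin_indep_columns m A B \<longleftrightarrow> cols_indep (Z - B) (B - Z) F"
proof -
  \<comment> \<open>Passing to coordinates keeps the kernel because the columns of \<open>A\<close>
    indexed by \<open>Z\<close> are independent.\<close>
  have ker: "(\<forall>i<m. (\<Sum>v\<in>B. c v * A i v) = 0) \<longleftrightarrow> (\<forall>z\<in>Z. (\<Sum>v\<in>B. F z v * c v) = 0)" for c
  proof -
    have "(\<Sum>v\<in>B. c v * A i v) = (\<Sum>z\<in>Z. (\<Sum>v\<in>B. F z v * c v) * A i z)" if "i < m" for i
    proof -
      have "(\<Sum>v\<in>B. c v * A i v) = (\<Sum>v\<in>B. \<Sum>z\<in>Z. F z v * c v * A i z)"
        using that by (intro sum.cong) (auto simp: FA sum_distrib_left mult_ac)
      also have "\<dots> = (\<Sum>z\<in>Z. \<Sum>v\<in>B. F z v * c v * A i z)" by (rule sum.swap)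
      finally show ?thesis by (simp only: sum_distrib_right)
    qed
    then show ?thesis
      using ind[unfolded lin_indep_columns_def, rule_format, of "\<lambda>z. \<Sum>v\<in>B. F z v * c v"] by auto
  qed
  have split: "(\<Sum>v\<in>B. F z v * c v) = (if z \<in> B then c z else 0) + (\<Sum>v\<in>B - Z. F z v * c v)"
    if "z \<in> Z" for z c
  proof -
    have "(\<Sum>v\<in>B. F z v * c v) = (\<Sum>v\<in>B \<inter> Z. F z v * c v) + (\<Sum>v\<in>B - Z. F z v * c v)"
      using fin(1) by (rule sum.Int_Diff)
    also have "(\<Sum>v\<in>B \<inter> Z. F z v * c v) = (\<Sum>v\<in>B \<inter> Z. if z = v then c v else 0)"
      using that by (intro sum.cong) (auto simp: FZ)
    also have "\<dots> = (if z \<in> B then c z else 0)" using fin that by simp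
    finally show ?thesis .
  qed
  show ?thesis
  proof
    assume lin: "lin_indep_columns m A B"
    show "cols_indep (Z - B) (B - Z) F"
      unfolding cols_indep_def
    proof (intro allI impI)
      fix c assume c: "\<forall>z\<in>Z - B. (\<Sum>v\<in>B - Z. F z v * c v) = 0"
      \<comment> \<open>The values on \<open>Z\<close> are chosen to cancel the contribution of
        \<open>B - Z\<close> in the rows of \<open>B \<inter> Z\<close>.\<close>
      define c' where "c' = (\<lambda>v. if v \<in> Z then \<Sum>u\<in>B - Z. F v u * c u else c v)"
      have c': "(\<Sum>v\<in>B - Z. F z v * c' v) = (\<Sum>v\<in>B - Z. F z v * c v)" for z
        by (intro sum.cong) (auto simp: c'_def)
      have "\<forall>z\<in>Z. (\<Sum>v\<in>B. F z v * c' v) = 0"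
      proof
        fix z assume z: "z \<in> Z"
        show "(\<Sum>v\<in>B. F z v * c' v) = 0"
          unfolding split[OF z] c' using z c by (cases "z \<in> B") (auto simp: c'_def)
      qed
      then have "\<forall>v\<in>B. c' v = 0" using lin ker unfolding lin_indep_columns_def by blast
      then show "\<forall>v\<in>B - Z. c v = 0" by (auto simp: c'_def split: if_splits)
    qed
  next
    assume cols: "cols_indep (Z - B) (B - Z) F"
    show "lin_indep_columns m A B"
      unfolding lin_indep_columns_def ker
    proof (intro allI impI)
      fix c assume c: "\<forall>z\<in>Z. (\<Sum>v\<in>B. F z v * c v) = 0"
      have "\<forall>z\<in>Z - B. (\<Sum>v\<in>B - Z. F z v * c v) = 0"
      proof
        fix z assume z: "z \<in> Z - B"
        then have "(\<Sum>v\<in>B. F z v * c v) = 0" using c by blast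
        then show "(\<Sum>v\<in>B - Z. F z v * c v) = 0" using z split[of z c] by simp
      qed
      then have c0: "\<forall>v\<in>B - Z. c v = 0" using cols unfolding cols_indep_def by blast
      show "\<forall>v\<in>B. c v = 0"
      proof
        fix v assume v: "v \<in> B"
        show "c v = 0"
        proof (cases "v \<in> Z")
          case True
          have "(\<Sum>u\<in>B - Z. F v u * c u) = 0" using c0 by (intro sum.neutral) auto
          then show ?thesis using split[OF True, of c] c True v by simp
        next
          case False
          then show ?thesis using c0 v by simp
        qed
      qed
    qed
  qed
qed

definition bipartite_matrix :: "'a set \<Rightarrow> ('a \<Rightarrow> 'a \<Rightarrow> bit) \<Rightarrow> 'a \<Rightarrow> 'a \<Rightarrow> bit" where
  "bipartite_matrix Z F a b =
     (if a \<in> Z \<and> b \<notin> Z then F a b else if a \<notin> Z \<and> b \<in> Z then F b a else 0)"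

text \<open>Both diagonal blocks are zero, so the kernel equations decouple into one system for each
  off-diagonal block, which are transposes of each other.\<close>

lemma trivial_kernel_bipartite_matrix:
  assumes fin: "finite B" "finite Z"
  shows "trivial_kernel (sym_diff B Z) (bipartite_matrix Z F) \<longleftrightarrow>
         cols_indep (Z - B) (B - Z) F \<and> cols_indep (B - Z) (Z - B) (\<lambda>v z. F z v)"
proof -
  let ?H = "bipartite_matrix Z F" and ?P = "Z - B" and ?Q = "B - Z"
  have sd: "sym_diff B Z = ?P \<union> ?Q" by auto
  have sums: "(\<Sum>v\<in>sym_diff B Z. ?H u v * c v) =
      (if u \<in> Z then \<Sum>v\<in>?Q. F u v * c v else \<Sum>v\<in>?P. F v u * c v)" for u c
  proof -
    have "(\<Sum>v\<in>sym_diff B Z. ?H u v * c v) = (\<Sum>v\<in>?P. ?H u v * c v) + (\<Sum>v\<in>?Q. ?H u v * c v)"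
      unfolding sd using fin by (intro sum.union_disjoint) auto
    moreover have "(\<Sum>v\<in>?P. ?H u v * c v) = (if u \<in> Z then 0 else \<Sum>v\<in>?P. F v u * c v)"
      by (auto simp: bipartite_matrix_def intro!: sum.cong sum.neutral)
    moreover have "(\<Sum>v\<in>?Q. ?H u v * c v) = (if u \<in> Z then \<Sum>v\<in>?Q. F u v * c v else 0)"
      by (auto simp: bipartite_matrix_def intro!: sum.cong sum.neutral)
    ultimately show ?thesis by simp
  qed
  have ker: "(\<forall>u\<in>sym_diff B Z. (\<Sum>v\<in>sym_diff B Z. ?H u v * c v) = 0) \<longleftrightarrow>
      (\<forall>z\<in>?P. (\<Sum>v\<in>?Q. F z v * c v) = 0) \<and> (\<forall>v\<in>?Q. (\<Sum>z\<in>?P. F z v * c z) = 0)" for c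
    unfolding sums by auto
  show ?thesis
  proof
    assume tk: "trivial_kernel (sym_diff B Z) ?H"
    have tk': "c v = 0" if "\<forall>z\<in>?P. (\<Sum>v\<in>?Q. F z v * c v) = 0"
      "\<forall>v\<in>?Q. (\<Sum>z\<in>?P. F z v * c z) = 0" "v \<in> sym_diff B Z" for c v
      using tk that ker[of c] unfolding trivial_kernel_def by blast
    show "cols_indep ?P ?Q F \<and> cols_indep ?Q ?P (\<lambda>v z. F z v)"
    proof
      show "cols_indep ?P ?Q F"
        unfolding cols_indep_def
      proof (intro allI impI ballI)
        fix c v assume c: "\<forall>z\<in>?P. (\<Sum>v\<in>?Q. F z v * c v) = 0" and v: "v \<in> ?Q"
        \<comment> \<open>Setting the values on \<open>Z\<close> to zero makes the equations of the
          other block trivial.\<close>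
        let ?c = "\<lambda>v. if v \<in> Z then 0 else c v"
        have "(\<Sum>v\<in>?Q. F z v * ?c v) = (\<Sum>v\<in>?Q. F z v * c v)" for z
          by (intro sum.cong) auto
        moreover have "(\<Sum>z\<in>?P. F z v * ?c z) = 0" for v by (intro sum.neutral) auto
        ultimately have "?c v = 0" using c v by (intro tk') auto
        then show "c v = 0" using v by simp
      qed
      show "cols_indep ?Q ?P (\<lambda>v z. F z v)"
        unfolding cols_indep_def
      proof (intro allI impI ballI)
        fix c z assume c: "\<forall>v\<in>?Q. (\<Sum>z\<in>?P. F z v * c z) = 0" and z: "z \<in> ?P"
        let ?c = "\<lambda>v. if v \<in> Z then c v else 0"
        have "(\<Sum>z\<in>?P. F z v * ?c z) = (\<Sum>z\<in>?P. F z v * c z)" for v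
          by (intro sum.cong) auto
        moreover have "(\<Sum>v\<in>?Q. F z v * ?c v) = 0" for z by (intro sum.neutral) auto
        ultimately have "?c z = 0" using c z by (intro tk') auto
        then show "c z = 0" using z by simp
      qed
    qed
  next
    assume "cols_indep ?P ?Q F \<and> cols_indep ?Q ?P (\<lambda>v z. F z v)"
    then show "trivial_kernel (sym_diff B Z) ?H"
      unfolding trivial_kernel_def ker cols_indep_def by blast
  qed
qed

lemma det_on_bipartite_matrix:
  fixes F :: "'a \<Rightarrow> 'a \<Rightarrow> bit"
  assumes M: "matroid M" and Z: "Z \<in> snd M"
    and A: "\<forall>X \<subseteq> fst M. indep_set M X \<longleftrightarrow> lin_indep_columns m A X"
    and FA: "\<And>i v. i < m \<Longrightarrow> v \<in> fst M \<Longrightarrow> A i v = (\<Sum>z\<in>Z. F z v * A i z)"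
    and FZ: "\<And>z u. z \<in> Z \<Longrightarrow> u \<in> Z \<Longrightarrow> F z u = of_bool (z = u)"
    and B: "B \<subseteq> fst M"
  shows "det_on (sym_diff B Z) (bipartite_matrix Z F) = of_bool (B \<in> snd M)"
proof -
  have ZV: "Z \<subseteq> fst M" and fin: "finite Z" "finite B"
    using matroid_basis_subset[OF M Z] matroid_basis_finite[OF M Z] finite_subset[OF B] M
    by (simp_all add: matroid_def)
  let ?P = "Z - B" and ?Q = "B - Z"
  have "card B = card ?Q + card (B \<inter> Z)" "card Z = card ?P + card (B \<inter> Z)"
    using fin by (auto simp: card_Diff_subset_Int Int_commute card_mono)
  then have card_iff: "card B = card Z \<longleftrightarrow> card ?P = card ?Q" by auto
  have "lin_indep_columns m A Z" using A ZV Z by (auto simp: indep_set_def)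
  then have lin: "indep_set M B \<longleftrightarrow> cols_indep ?P ?Q F"
    using lin_indep_columns_iff_cols_indep[OF fin(2,1), of m A F] A B FA FZ by blast
  have "B \<in> snd M \<longleftrightarrow> cols_indep ?P ?Q F \<and> card ?P = card ?Q"
    unfolding basis_iff_indep_card[OF M Z, of B] lin card_iff ..
  \<comment> \<open>Independent columns of a square block give independent rows; conversely,
    independence of both bounds each side of the block by the other.\<close>
  also have "\<dots> \<longleftrightarrow> cols_indep ?P ?Q F \<and> cols_indep ?Q ?P (\<lambda>v z. F z v)"
    using cols_indep_transpose[of ?P ?Q F] cols_indep_card_le[of ?P ?Q F]
      cols_indep_card_le[of ?Q ?P "\<lambda>v z. F z v"] fin by auto
  also have "\<dots> \<longleftrightarrow> trivial_kernel (sym_diff B Z) (bipartite_matrix Z F)"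
    by (rule trivial_kernel_bipartite_matrix[OF fin(2,1), symmetric])
  also have "\<dots> \<longleftrightarrow> nonsingular_on (sym_diff B Z) (bipartite_matrix Z F)"
    using fin by (intro nonsingular_on_iff_trivial_kernel[symmetric]) auto
  finally show ?thesis unfolding nonsingular_on_def by (auto simp: of_bool_def)
qed

section \<open>The graph of the twisted dual pivot and the Penrose identity\<close>

lemma binary_matroid_dual_pivot_twist_graph:
  assumes "binary_matroid M" and Z: "Z \<in> snd M"
  obtains G where "graph_on (fst M) G" "M \<^bold>*\<^bold>- fst M \<^bold>* Z = graph_set_system (fst M) G"
proof -
  let ?V = "fst M"
  obtain m A where M: "matroid M" and A: "\<forall>X \<subseteq> ?V. indep_set M X \<longleftrightarrow> lin_indep_columns m A X"
    using assms(1) unfolding binary_matroid_def by blast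
  have finV: "finite ?V" and sub: "snd M \<subseteq> Pow ?V" using M unfolding matroid_def by auto
  have ZV: "Z \<subseteq> ?V" using sub Z by auto
  have finZ: "finite Z" using ZV finV by (rule finite_subset)
  obtain F where F: "\<And>i v. i < m \<Longrightarrow> v \<in> ?V \<Longrightarrow> A i v = (\<Sum>z\<in>Z. F z v * A i z)"
    "\<And>z u. z \<in> Z \<Longrightarrow> u \<in> Z \<Longrightarrow> F z u = of_bool (z = u)"
    using fundamental_coordinates[OF M Z A] by blast
  define H where "H = bipartite_matrix Z F"
  define K where "K = (\<lambda>a b. H a b + of_bool (a = b \<and> a \<in> Z))"
  \<comment> \<open>\<open>K\<close> is zero between vertices outside \<open>Z\<close>, as
    \<open>H\<close> is bipartite and the loops lie in \<open>Z\<close>. Hence one sum performs the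
    steps at all these vertices.\<close>
  define G where "G = (\<lambda>a b. K a b + (\<Sum>v\<in>?V - Z. K a v * K v b))"
  have detH: "det_on (sym_diff B Z) H = of_bool (B \<in> snd M)" if "B \<subseteq> ?V" for B
    unfolding H_def by (rule det_on_bipartite_matrix[OF M Z A F that])
  have K_sym: "K a b = K b a" for a b by (auto simp: K_def H_def bipartite_matrix_def)
  have "G a b = G b a" for a b
    unfolding G_def by (simp add: K_sym[of a] K_sym[of _ b] mult.commute)
  then have graph: "graph_on ?V G" by (simp add: graph_on_def)
  have detG: "det_on Y G = of_nat (card {B \<in> snd M. sym_diff Y Z \<subseteq> B})" if Y: "Y \<subseteq> ?V" for Y
  proof -
    have finY: "finite Y" using Y finV by (rule finite_subset)
    have "det_on Y G = (\<Sum>S\<in>Pow (?V - Z - Y). det_on (Y \<union> S) K)"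
      unfolding G_def using finV finY
      by (intro det_on_dual_steps) (auto simp: K_def H_def bipartite_matrix_def)
    also have "\<dots> = (\<Sum>S\<in>Pow (?V - Z - Y). \<Sum>R\<in>Pow (Z \<inter> Y). det_on (Y \<union> S - R) H)"
    proof (rule sum.cong[OF refl])
      fix S assume S: "S \<in> Pow (?V - Z - Y)"
      then have "finite (Y \<union> S)" using finV finY by (auto intro: finite_subset)
      moreover have "Z \<inter> (Y \<union> S) = Z \<inter> Y" using S by auto
      ultimately show "det_on (Y \<union> S) K = (\<Sum>R\<in>Pow (Z \<inter> Y). det_on (Y \<union> S - R) H)"
        unfolding K_def using det_on_add_loops[OF finZ, of "Y \<union> S" H] by simp
    qed
    also have "\<dots> = (\<Sum>(S, R)\<in>Pow (?V - Z - Y) \<times> Pow (Z \<inter> Y). det_on (Y \<union> S - R) H)"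
      by (rule sum.cartesian_product)
    also have "\<dots> = (\<Sum>B | sym_diff Y Z \<subseteq> B \<and> B \<subseteq> ?V. det_on (sym_diff B Z) H)"
    \<comment> \<open>Twisting \<open>Y \<union> S - R\<close> by \<open>Z\<close> gives the union
      of \<open>sym_diff Y Z\<close>, \<open>S\<close> and \<open>R\<close>. Since \<open>S\<close>
      and \<open>R\<close> range freely over the two pieces of the complement of
      \<open>sym_diff Y Z\<close>, every \<open>B\<close> between \<open>sym_diff Y Z\<close> and
      \<open>?V\<close> arises exactly once.\<close>
    proof (rule sum.reindex_bij_witness[where
          j = "\<lambda>(S, R). sym_diff (Y \<union> S - R) Z" and
          i = "\<lambda>B. (sym_diff B Z - Y, Y - sym_diff B Z)"])
      fix SR assume SR: "SR \<in> Pow (?V - Z - Y) \<times> Pow (Z \<inter> Y)"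
      obtain S R where SR_eq: "SR = (S, R)" by fastforce
      have S: "S \<subseteq> ?V - Z - Y" and R: "R \<subseteq> Z \<inter> Y" using SR SR_eq by auto
      have inv: "sym_diff (sym_diff (Y \<union> S - R) Z) Z = Y \<union> S - R" by auto
      show "(\<lambda>B. (sym_diff B Z - Y, Y - sym_diff B Z)) ((\<lambda>(S, R). sym_diff (Y \<union> S - R) Z) SR) = SR"
        unfolding SR_eq prod.case inv using S R by auto
      show "(\<lambda>(S, R). sym_diff (Y \<union> S - R) Z) SR \<in> {B. sym_diff Y Z \<subseteq> B \<and> B \<subseteq> ?V}"
        unfolding SR_eq prod.case using S R Y ZV by blast
      show "det_on (sym_diff ((\<lambda>(S, R). sym_diff (Y \<union> S - R) Z) SR) Z) H =
          (case SR of (S, R) \<Rightarrow> det_on (Y \<union> S - R) H)"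
        unfolding SR_eq prod.case inv ..
    next
      fix B assume "B \<in> {B. sym_diff Y Z \<subseteq> B \<and> B \<subseteq> ?V}"
      then have B: "sym_diff Y Z \<subseteq> B" "B \<subseteq> ?V" by auto
      have "Y \<union> (sym_diff B Z - Y) - (Y - sym_diff B Z) = sym_diff B Z" by auto
      moreover have "sym_diff (sym_diff B Z) Z = B" by auto
      ultimately show "(\<lambda>(S, R). sym_diff (Y \<union> S - R) Z) (sym_diff B Z - Y, Y - sym_diff B Z) = B"
        by (simp only: prod.case)
      show "(sym_diff B Z - Y, Y - sym_diff B Z) \<in> Pow (?V - Z - Y) \<times> Pow (Z \<inter> Y)"
        using B by blast
    qed
    also have "\<dots> = (\<Sum>B | sym_diff Y Z \<subseteq> B \<and> B \<subseteq> ?V. of_bool (B \<in> snd M))"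
      by (intro sum.cong refl detH) auto
    also have "\<dots> = of_nat (card {B. (sym_diff Y Z \<subseteq> B \<and> B \<subseteq> ?V) \<and> B \<in> snd M})"
      using finV by (simp add: Int_def)
    also have "{B. (sym_diff Y Z \<subseteq> B \<and> B \<subseteq> ?V) \<and> B \<in> snd M} = {B \<in> snd M. sym_diff Y Z \<subseteq> B}"
      using sub by auto
    finally show ?thesis .
  qed
  have mem: "Y \<in> snd (M \<^bold>*\<^bold>- ?V \<^bold>* Z) \<longleftrightarrow> nonsingular_on Y G" if Y: "Y \<subseteq> ?V" for Y
  proof -
    have "Y \<in> snd (M \<^bold>*\<^bold>- ?V \<^bold>* Z) \<longleftrightarrow> odd (card {B \<in> snd M. sym_diff Y Z \<subseteq> B})"
      unfolding mem_twist_iff using Y ZV by (intro mem_dual_pivot_ground_iff[OF sub]) auto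
    \<comment> \<open>Casting the count to \<open>bit\<close> preserves its parity.\<close>
    also have "\<dots> \<longleftrightarrow> odd (det_on Y G)" unfolding detG[OF Y] even_of_nat_iff ..
    also have "\<dots> \<longleftrightarrow> nonsingular_on Y G"
      unfolding nonsingular_on_def by (cases "det_on Y G") auto
    finally show ?thesis .
  qed
  have "snd (M \<^bold>*\<^bold>- ?V \<^bold>* Z) \<subseteq> Pow ?V" using ZV by (auto simp: twist_def dual_pivot_def)
  then have "snd (M \<^bold>*\<^bold>- ?V \<^bold>* Z) = snd (graph_set_system ?V G)"
    using mem unfolding graph_set_system_def by auto
  then have "M \<^bold>*\<^bold>- ?V \<^bold>* Z = graph_set_system ?V G"
    by (intro prod_eqI) (simp_all add: twist_def dual_pivot_def graph_set_system_def)
  with graph show thesis by (rule that)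
qed

theorem theorem8:
  fixes V :: "'a set" and \<B> :: "'a set set" and M :: "'a set_system" and Z :: "'a set"
  assumes "M = (V, \<B>)"
    and "binary_matroid M"
    and "Z \<in> \<B>"
  shows "\<exists>G. graph_on V G \<and>
             M \<^bold>*\<^bold>- V \<^bold>* Z = graph_set_system V G \<and>
             penrose_poly M = (-1) ^ nullity M * p1 V G"
proof -
  have V: "fst M = V" and Z: "Z \<in> snd M" using assms by auto
  have M: "matroid M" using assms(2) by (simp add: binary_matroid_def)
  then have fin: "finite (fst M)" and sub: "snd M \<subseteq> Pow (fst M)" by (auto simp: matroid_def)
  obtain G where G: "graph_on V G" "M \<^bold>*\<^bold>- V \<^bold>* Z = graph_set_system V G"
    using binary_matroid_dual_pivot_twist_graph[OF assms(2) Z] unfolding V by blast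
  have "Z \<subseteq> fst M" using sub Z by auto
  \<comment> \<open>All bases have the size of \<open>Z\<close>, so the sign exponent is the
    nullity; the system being twisted is that of \<open>G\<close>.\<close>
  from penrose_poly_eq_sum_twists[OF fin sub this]
  have "penrose_poly M = (-1) ^ nullity M * p1 V G"
    unfolding V nullity_def matroid_rank_eq_card_basis[OF M Z] p1_def G(2) .
  with G show ?thesis by blast
qed

end
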